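(* Let $X$ and $Y$ be Hausdorff topological spaces and let $f:X\to Y$ be a continuous surjective irreducible perfect map, where $X$ is regular and has a $G_{\delta}$-diagonal. If $Y$ has a uniform base at non-isolated points, then $X$ has a uniform base at non-isolated points.
   Context: A map $f:X\to Y$ is perfect if it is closed and each fiber $f^{-1}(y)$ is compact. A surjective map $f:X\to Y$ is irreducible if there is no proper closed subset $X'$ of $X$ with $f(X')=Y$. Uniform base at non-isolated points: a base $\mathcal{P}$ of a space $X$ such that for each non-isolated point $x\in X$ and any countably infinite subset $\mathcal{P}'$ of $\{P\in\mathcal{P}: x\in P\}$, $\mathcal{P}'$ is a neighborhood base at $x$ in $X$. *)

theory Defs
  imports "HOL-Analysis.Analysis"
begin

definition irreducible_map :: "'a topology \<Rightarrow> 'b topology \<Rightarrow> ('a \<Rightarrow> 'b) \<Rightarrow> bool" where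
  "irreducible_map X Y f \<longleftrightarrow>
     f ` topspace X = topspace Y \<and>
     \<not> (\<exists>C. closedin X C \<and> C \<subset> topspace X \<and> f ` C = topspace Y)"

definition has_gdelta_diagonal :: "'a topology \<Rightarrow> bool" where
  "has_gdelta_diagonal X \<longleftrightarrow> gdelta_in (prod_topology X X) ((\<lambda>x. (x, x)) ` topspace X)"

definition topology_base :: "'a topology \<Rightarrow> 'a set set \<Rightarrow> bool" where
  "topology_base X \<P> \<longleftrightarrow> openin X = arbitrary union_of (\<lambda>P. P \<in> \<P>)"

definition isolated_point :: "'a topology \<Rightarrow> 'a \<Rightarrow> bool" where
  "isolated_point X x \<longleftrightarrow> openin X {x}"

(* The members of \<Q> are open sets containing x, so neighbourhood_base_at says exactly
   that the family \<Q> is a neighbourhood base at x. *)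
definition uniform_base_at_nonisolated :: "'a topology \<Rightarrow> 'a set set \<Rightarrow> bool" where
  "uniform_base_at_nonisolated X \<P> \<longleftrightarrow>
     topology_base X \<P> \<and>
     (\<forall>x \<in> topspace X. \<not> isolated_point X x \<longrightarrow>
        (\<forall>\<Q>. \<Q> \<subseteq> {P \<in> \<P>. x \<in> P} \<and> countable \<Q> \<and> infinite \<Q> \<longrightarrow>
             neighbourhood_base_at x (\<lambda>V. V \<in> \<Q>) X))"

definition has_uniform_base_at_nonisolated :: "'a topology \<Rightarrow> bool" where
  "has_uniform_base_at_nonisolated X \<longleftrightarrow> (\<exists>\<P>. uniform_base_at_nonisolated X \<P>)"

end

theory Submission
  imports Defs
begin

text \<open>
  A base is uniform at the non-isolated points iff every neighbourhood of a non-isolated point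
  contains all but finitely many of the members of the base around that point. Consequently each
  member around a non-isolated point has only finitely many supersets in the base, and the maximal
  members of a subfamily covering the non-isolated points form a refinement that is point-finite
  there. Doing this with the members that have at least \<open>n\<close> proper supersets gives, on \<open>Y\<close>,
  point-finite families \<open>\<M> n\<close>, shrinking to each non-isolated point, that refine any prescribed
  sequence of open covers.

  Cover each fibre of \<open>f\<close> by finitely many open sets whose closures have their squares inside the
  \<open>n\<close>-th open set \<open>D n\<close> of the \<open>G\<^sub>\<delta>\<close>-diagonal, let \<open>\<M> n\<close> refine the resulting cover of \<open>Y\<close>, and
  cut the preimages of the members of \<open>\<M> n\<close> by these open sets. Around a point \<open>x\<close>, the
  \<open>G\<^sub>\<delta>\<close>-diagonal separates the resulting sets from the other points of the compact fibre of \<open>x\<close>, and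
  closedness of \<open>f\<close> confines them to a neighbourhood of that fibre, so that they shrink to \<open>x\<close>.
  Irreducibility ensures that non-isolated points are mapped to non-isolated points.
\<close>

section \<open>Uniform bases and point-finite developments\<close>

text \<open>Infinitely many members around \<open>x\<close> not inside \<open>W\<close> would
  contain a countably infinite subfamily with no member inside \<open>W\<close>. Conversely, an
  infinite \<open>\<Q>\<close> cannot fit into the finite exceptional set. The counting form is
  easier to use below.\<close>

lemma uniform_base_at_nonisolated_iff:
  "uniform_base_at_nonisolated X \<P> \<longleftrightarrow>
     topology_base X \<P> \<and>
     (\<forall>x W. openin X W \<and> x \<in> W \<and> \<not> isolated_point X x \<longrightarrow> finite {P \<in> \<P>. x \<in> P \<and> \<not> P \<subseteq> W})"
    (is "_ \<longleftrightarrow> _ \<and> ?fin")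
proof -
  have "?fin" if u: "uniform_base_at_nonisolated X \<P>"
  proof (intro allI impI, rule ccontr)
    fix x W
    assume x: "openin X W \<and> x \<in> W \<and> \<not> isolated_point X x"
      and "infinite {P \<in> \<P>. x \<in> P \<and> \<not> P \<subseteq> W}"
    then obtain \<Q> where \<Q>: "\<Q> \<subseteq> {P \<in> \<P>. x \<in> P \<and> \<not> P \<subseteq> W}" "countable \<Q>" "infinite \<Q>"
      using infinite_countable_subset' by blast
    moreover have "x \<in> topspace X"
      using x openin_subset by blast
    ultimately have "neighbourhood_base_at x (\<lambda>V. V \<in> \<Q>) X"
      using u x unfolding uniform_base_at_nonisolated_def by blast
    then show False
      using \<Q>(1) x unfolding neighbourhood_base_at_def by blast
  qed
  moreover have "uniform_base_at_nonisolated X \<P>" if b: "topology_base X \<P>" and fin: ?fin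
    unfolding uniform_base_at_nonisolated_def neighbourhood_base_at_def
  proof (intro conjI ballI impI allI b)
    fix x \<Q> W
    assume x: "\<not> isolated_point X x" "openin X W \<and> x \<in> W"
      and \<Q>: "\<Q> \<subseteq> {P \<in> \<P>. x \<in> P} \<and> countable \<Q> \<and> infinite \<Q>"
    have "\<not> \<Q> \<subseteq> {P \<in> \<P>. x \<in> P \<and> \<not> P \<subseteq> W}"
      using fin x \<Q> finite_subset by blast
    then obtain V where V: "V \<in> \<Q>" "V \<subseteq> W" "x \<in> V" "V \<in> \<P>"
      using \<Q> by blast
    then have "openin X V"
      using b unfolding topology_base_def openin_topology_base_unique by blast
    with V show "\<exists>U V. openin X U \<and> V \<in> \<Q> \<and> x \<in> U \<and> U \<subseteq> V \<and> V \<subseteq> W"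
      by blast
  qed
  moreover have "uniform_base_at_nonisolated X \<P> \<Longrightarrow> topology_base X \<P>"
    by (simp add: uniform_base_at_nonisolated_def)
  ultimately show ?thesis
    by blast
qed

lemma uniform_base_openin:
  "\<lbrakk>uniform_base_at_nonisolated X \<P>; P \<in> \<P>\<rbrakk> \<Longrightarrow> openin X P"
  unfolding uniform_base_at_nonisolated_def topology_base_def openin_topology_base_unique by blast

lemma uniform_base_inside:
  "\<lbrakk>uniform_base_at_nonisolated X \<P>; openin X W; x \<in> W\<rbrakk> \<Longrightarrow> \<exists>P\<in>\<P>. x \<in> P \<and> P \<subseteq> W"
  unfolding uniform_base_at_nonisolated_def topology_base_def openin_topology_base_unique by blast

text \<open>The device for the finiteness arguments: \<open>W - {z}\<close> is a neighbourhood of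
  \<open>x\<close> that contains no superset of \<open>W\<close>.\<close>

lemma nonisolated_delete_point:
  assumes "t1_space X" "\<not> isolated_point X x" "openin X W" "x \<in> W"
  obtains z where "z \<in> W" "z \<noteq> x" "openin X (W - {z})"
proof -
  have "W \<noteq> {x}"
    using assms unfolding isolated_point_def by blast
  then obtain z where "z \<in> W" "z \<noteq> x"
    using assms by blast
  moreover have "openin X (W - {z})"
    using assms \<open>z \<in> W\<close> unfolding t1_space_openin_delete by blast
  ultimately show thesis
    by (rule that)
qed

lemma finite_supersets_uniform_base:
  assumes "t1_space X" "uniform_base_at_nonisolated X \<P>" "\<not> isolated_point X x"
    and "openin X S" "x \<in> S"
  shows "finite {P \<in> \<P>. S \<subseteq> P}"
proof -
  obtain z where z: "z \<in> S" "z \<noteq> x" "openin X (S - {z})"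
    using nonisolated_delete_point assms by metis
  then have "finite {P \<in> \<P>. x \<in> P \<and> \<not> P \<subseteq> S - {z}}"
    using assms unfolding uniform_base_at_nonisolated_iff by blast
  then show ?thesis
    by (rule rev_finite_subset) (use z assms in blast)
qed

text \<open>Existence: \<open>R\<close> has only finitely many supersets in \<open>\<R>\<close>, and
  a maximal one of these is maximal in all of \<open>\<R>\<close>. Finiteness: let \<open>M\<close>
  be one maximal member around \<open>x\<close> and \<open>z\<close> another point of
  \<open>M\<close>. A maximal member inside \<open>M - {z}\<close> would be a proper subset of
  \<open>M\<close>, so every maximal member around \<open>x\<close> is exceptional for
  \<open>M - {z}\<close>.\<close>

lemma maximal_members_point_finite:
  assumes t1: "t1_space X" and u: "uniform_base_at_nonisolated X \<P>" and "\<R> \<subseteq> \<P>"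
    and x: "\<not> isolated_point X x" and "R \<in> \<R>" "x \<in> R"
  defines "\<M> \<equiv> {P \<in> \<R>. \<forall>Q\<in>\<R>. P \<subseteq> Q \<longrightarrow> Q = P}"
  shows "\<exists>P\<in>\<M>. x \<in> P" and "finite {P \<in> \<M>. x \<in> P}"
proof -
  have op: "openin X P" if "P \<in> \<R>" for P
    using that u \<open>\<R> \<subseteq> \<P>\<close> uniform_base_openin by blast
  have "finite {P \<in> \<P>. R \<subseteq> P}"
    using finite_supersets_uniform_base[OF t1 u x op[OF \<open>R \<in> \<R>\<close>] \<open>x \<in> R\<close>] .
  then have "finite {P \<in> \<R>. R \<subseteq> P}"
    by (rule rev_finite_subset) (use \<open>\<R> \<subseteq> \<P>\<close> in blast)
  from finite_has_maximal[OF this] obtain M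
    where M: "M \<in> \<R>" "R \<subseteq> M" "\<forall>b\<in>{P \<in> \<R>. R \<subseteq> P}. M \<subseteq> b \<longrightarrow> M = b"
    using \<open>R \<in> \<R>\<close> by blast
  have "M \<in> \<M>"
    using M unfolding \<M>_def by blast
  then show "\<exists>P\<in>\<M>. x \<in> P"
    using M \<open>x \<in> R\<close> by blast
  obtain z where z: "z \<in> M" "z \<noteq> x" "openin X (M - {z})"
    using nonisolated_delete_point[OF t1 x op[OF M(1)]] M(2) \<open>x \<in> R\<close> by blast
  then have "finite {P \<in> \<P>. x \<in> P \<and> \<not> P \<subseteq> M - {z}}"
    using u x M(2) \<open>x \<in> R\<close> unfolding uniform_base_at_nonisolated_iff by blast
  then show "finite {P \<in> \<M>. x \<in> P}"
    by (rule rev_finite_subset) (use z \<open>M \<in> \<M>\<close> \<open>\<R> \<subseteq> \<P>\<close> in \<open>unfold \<M>_def, blast\<close>)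
qed

text \<open>Call the number of proper supersets in \<open>\<P>\<close> the depth of a member.
  Deleting a point of \<open>P\<close> and choosing a member \<open>P'\<close> around
  \<open>x\<close> in the rest raises the depth, as \<open>P\<close> itself becomes a proper
  superset.\<close>

lemma deep_member_uniform_base:
  assumes t1: "t1_space X" and u: "uniform_base_at_nonisolated X \<P>"
    and x: "\<not> isolated_point X x" and W: "openin X W" "x \<in> W"
  shows "\<exists>P\<in>\<P>. x \<in> P \<and> P \<subseteq> W \<and> n \<le> card {Q \<in> \<P>. P \<subset> Q}"
proof (induction n)
  case 0
  then show ?case
    using uniform_base_inside[OF u W] by blast
next
  case (Suc n)
  then obtain P where P: "P \<in> \<P>" "x \<in> P" "P \<subseteq> W" "n \<le> card {Q \<in> \<P>. P \<subset> Q}"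
    by blast
  obtain z where z: "z \<in> P" "z \<noteq> x" "openin X (P - {z})"
    using nonisolated_delete_point[OF t1 x uniform_base_openin[OF u P(1)] P(2)] by blast
  obtain P' where P': "P' \<in> \<P>" "x \<in> P'" "P' \<subseteq> P - {z}"
    using uniform_base_inside[OF u z(3)] P(2) z(2) by blast
  \<comment> \<open>Finiteness matters because \<open>card\<close> of an infinite set is 0.\<close>
  have "finite {Q \<in> \<P>. P' \<subseteq> Q}"
    using finite_supersets_uniform_base[OF t1 u x] uniform_base_openin[OF u] P' by blast
  then have fin: "finite {Q \<in> \<P>. P' \<subset> Q}"
    by (rule rev_finite_subset) blast
  have "insert P {Q \<in> \<P>. P \<subset> Q} \<subseteq> {Q \<in> \<P>. P' \<subset> Q}"
    using P P' z by blast
  note card_mono[OF fin this] finite_subset[OF this fin]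
  then have "Suc n \<le> card {Q \<in> \<P>. P' \<subset> Q}"
    using P(4) by simp
  then show ?case
    using P P' by blast
qed

text \<open>The last clause says that the stars of \<open>x\<close> eventually enter each
  neighbourhood of \<open>x\<close>; the families need not refine one another. Nothing is asked at
  isolated points, whose singletons are added to the base later.\<close>

definition point_finite_development :: "'a topology \<Rightarrow> (nat \<Rightarrow> 'a set set) \<Rightarrow> bool" where
  "point_finite_development X \<W> \<longleftrightarrow>
     (\<forall>n. \<forall>W\<in>\<W> n. openin X W) \<and>
     (\<forall>x\<in>topspace X. \<not> isolated_point X x \<longrightarrow>
        (\<forall>n. (\<exists>W\<in>\<W> n. x \<in> W) \<and> finite {W \<in> \<W> n. x \<in> W})) \<and>
     (\<forall>x U. openin X U \<and> x \<in> U \<and> \<not> isolated_point X x \<longrightarrow>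
        (\<forall>\<^sub>F n in sequentially. \<forall>W\<in>\<W> n. x \<in> W \<longrightarrow> W \<subseteq> U))"

lemma point_finite_development_refining:
  assumes t1: "t1_space X" and "has_uniform_base_at_nonisolated X"
    and \<H>: "\<And>n H. H \<in> \<H> n \<Longrightarrow> openin X H" "\<And>n. topspace X \<subseteq> \<Union> (\<H> n)"
  shows "\<exists>\<M>. point_finite_development X \<M> \<and> (\<forall>n. \<forall>M\<in>\<M> n. \<exists>H\<in>\<H> n. M \<subseteq> H)"
proof -
  obtain \<P> where u: "uniform_base_at_nonisolated X \<P>"
    using assms unfolding has_uniform_base_at_nonisolated_def by blast
  define \<R> where "\<R> n = {P \<in> \<P>. n \<le> card {Q \<in> \<P>. P \<subset> Q} \<and> (\<exists>H\<in>\<H> n. P \<subseteq> H)}" for n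
  define \<M> where "\<M> n = {P \<in> \<R> n. \<forall>Q\<in>\<R> n. P \<subseteq> Q \<longrightarrow> Q = P}" for n
  have sub: "\<R> n \<subseteq> \<P>" for n
    unfolding \<R>_def by blast
  have cov: "\<exists>R\<in>\<R> n. x \<in> R" if x: "x \<in> topspace X" "\<not> isolated_point X x" for n x
  proof -
    obtain H where "H \<in> \<H> n" "x \<in> H"
      using x \<H>(2) by blast
    then show ?thesis
      using deep_member_uniform_base[OF t1 u x(2), of H n] \<H>(1) unfolding \<R>_def by blast
  qed
  have op: "openin X M" if "M \<in> \<M> n" for n M
    using that sub uniform_base_openin[OF u] unfolding \<M>_def by blast
  have refine: "\<exists>H\<in>\<H> n. M \<subseteq> H" if "M \<in> \<M> n" for n M
    using that unfolding \<M>_def \<R>_def by blast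
  have point: "(\<exists>M\<in>\<M> n. x \<in> M) \<and> finite {M \<in> \<M> n. x \<in> M}"
    if x: "x \<in> topspace X" "\<not> isolated_point X x" for n x
  proof -
    obtain R where "R \<in> \<R> n" "x \<in> R"
      using cov[OF x] by blast
    from maximal_members_point_finite[OF t1 u sub x(2) this] show ?thesis
      unfolding \<M>_def ..
  qed
  have dev: "\<forall>\<^sub>F n in sequentially. \<forall>M\<in>\<M> n. x \<in> M \<longrightarrow> M \<subseteq> W"
    if "openin X W" "x \<in> W" "\<not> isolated_point X x" for x W
  proof -
    let ?B = "{P \<in> \<P>. x \<in> P \<and> \<not> P \<subseteq> W}"
    have "finite ?B"
      using u that unfolding uniform_base_at_nonisolated_iff by blast
    \<comment> \<open>Once \<open>n\<close> exceeds the depths of the finitely many members in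
      \<open>?B\<close>, none of them can belong to \<open>\<R> n\<close>, which demands depth at
      least \<open>n\<close>.\<close>
    then have "\<forall>\<^sub>F n in sequentially. \<forall>P\<in>?B. card {Q \<in> \<P>. P \<subset> Q} < n"
      by (rule eventually_ball_finite) (simp add: eventually_gt_at_top)
    then show ?thesis
    proof eventually_elim
      case (elim n)
      show ?case
      proof (intro ballI impI, rule ccontr)
        fix M assume M: "M \<in> \<M> n" "x \<in> M" "\<not> M \<subseteq> W"
        then have "M \<in> \<P>" "n \<le> card {Q \<in> \<P>. M \<subset> Q}"
          unfolding \<M>_def \<R>_def by blast+
        with M elim show False
          by fastforce
      qed
    qed
  qed
  have "point_finite_development X \<M>"
    unfolding point_finite_development_def using op point dev by simp
  then show ?thesis
    using refine by blast
qed

text \<open>The base is the union of all families together with the isolated singletons. Around a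
  non-isolated point, a member not inside \<open>U\<close> can only come from the stages before some
  \<open>N\<close>, each contributing finitely many.\<close>

lemma has_uniform_base_if_development:
  assumes "point_finite_development X \<W>"
  shows "has_uniform_base_at_nonisolated X"
proof -
  have op: "openin X W" if "W \<in> \<W> n" for n W
    using assms that unfolding point_finite_development_def by simp
  have cov: "\<exists>W\<in>\<W> n. x \<in> W" and fin: "finite {W \<in> \<W> n. x \<in> W}"
    if "x \<in> topspace X" "\<not> isolated_point X x" for n x
    using assms that unfolding point_finite_development_def by simp_all
  have dev: "\<forall>\<^sub>F n in sequentially. \<forall>W\<in>\<W> n. x \<in> W \<longrightarrow> W \<subseteq> U"
    if "openin X U" "x \<in> U" "\<not> isolated_point X x" for x U
    using assms that unfolding point_finite_development_def by simp
  define \<P> where "\<P> = (\<Union>n. \<W> n) \<union> {{x} |x. isolated_point X x}"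
  have "topology_base X \<P>"
    unfolding topology_base_def openin_topology_base_unique
  proof (intro conjI allI impI)
    show "openin X V" if "V \<in> \<P>" for V
      using that op unfolding \<P>_def isolated_point_def by blast
    fix U x
    assume U: "openin X U \<and> x \<in> U"
    then have x: "x \<in> topspace X"
      using openin_subset by blast
    show "\<exists>V. V \<in> \<P> \<and> x \<in> V \<and> V \<subseteq> U"
    proof (cases "isolated_point X x")
      case True
      then show ?thesis
        using U unfolding \<P>_def by blast
    next
      case False
      then obtain n where "\<forall>W\<in>\<W> n. x \<in> W \<longrightarrow> W \<subseteq> U"
        using eventually_happens'[OF sequentially_bot dev] U by blast
      then show ?thesis
        using cov[OF x False, of n] unfolding \<P>_def by blast
    qed
  qed
  moreover have "finite {P \<in> \<P>. x \<in> P \<and> \<not> P \<subseteq> U}"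
    if U: "openin X U" "x \<in> U" "\<not> isolated_point X x" for x U
  proof -
    have x: "x \<in> topspace X"
      using U openin_subset by blast
    obtain N where N: "\<And>n W. \<lbrakk>n \<ge> N; W \<in> \<W> n; x \<in> W\<rbrakk> \<Longrightarrow> W \<subseteq> U"
      using dev[OF U] unfolding eventually_sequentially by metis
    have "finite (\<Union>n<N. {W \<in> \<W> n. x \<in> W})"
      by (intro finite_UN_I fin[OF x U(3)] finite_lessThan)
    moreover have "{P \<in> \<P>. x \<in> P \<and> \<not> P \<subseteq> U} \<subseteq> (\<Union>n<N. {W \<in> \<W> n. x \<in> W})"
    proof
      fix P assume P: "P \<in> {P \<in> \<P>. x \<in> P \<and> \<not> P \<subseteq> U}"
      then obtain n where "P \<in> \<W> n"
        using U unfolding \<P>_def by blast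
      then show "P \<in> (\<Union>n<N. {W \<in> \<W> n. x \<in> W})"
        using N[of n P] P by fastforce
    qed
    ultimately show ?thesis
      by (rule rev_finite_subset)
  qed
  ultimately show ?thesis
    unfolding has_uniform_base_at_nonisolated_def uniform_base_at_nonisolated_iff by blast
qed

section \<open>Intersections across the first \<open>n + 1\<close> families\<close>

fun meets :: "(nat \<Rightarrow> 'a set set) \<Rightarrow> nat \<Rightarrow> 'a set set" where
  "meets \<V> 0 = \<V> 0"
| "meets \<V> (Suc n) = (\<lambda>(A, B). A \<inter> B) ` (meets \<V> n \<times> \<V> (Suc n))"

lemma openin_meets:
  assumes "\<And>n V. V \<in> \<V> n \<Longrightarrow> openin X V"
  shows "A \<in> meets \<V> n \<Longrightarrow> openin X A"
  by (induction n arbitrary: A) (auto intro: assms)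

lemma meets_cover:
  assumes "\<And>n. \<exists>V\<in>\<V> n. x \<in> V"
  shows "\<exists>A\<in>meets \<V> n. x \<in> A"
proof (induction n)
  case (Suc n)
  then obtain A where A: "A \<in> meets \<V> n" "x \<in> A"
    by blast
  obtain V where V: "V \<in> \<V> (Suc n)" "x \<in> V"
    using assms by blast
  from A V have "(\<lambda>(A, B). A \<inter> B) (A, V) \<in> meets \<V> (Suc n)"
    unfolding meets.simps by (intro imageI) simp
  then show ?case
    using A V by auto
qed (simp add: assms)

lemma meets_point_finite:
  assumes "\<And>n. finite {V \<in> \<V> n. x \<in> V}"
  shows "finite {A \<in> meets \<V> n. x \<in> A}"
proof (induction n)
  case 0
  then show ?case
    using assms by simp
next
  case (Suc n)
  then have "finite ((\<lambda>(A, B). A \<inter> B) ` ({A \<in> meets \<V> n. x \<in> A} \<times> {V \<in> \<V> (Suc n). x \<in> V}))"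
    using assms by blast
  then show ?case
    by (rule rev_finite_subset) auto
qed

text \<open>The purpose of \<open>meets\<close>: what family \<open>i\<close> achieves persists at
  all later stages, as the shrinking condition of a development requires.\<close>

lemma meets_refine: "\<lbrakk>A \<in> meets \<V> n; i \<le> n\<rbrakk> \<Longrightarrow> \<exists>V\<in>\<V> i. A \<subseteq> V"
proof (induction n arbitrary: A)
  case (Suc n)
  then obtain B V where BV: "A = B \<inter> V" "B \<in> meets \<V> n" "V \<in> \<V> (Suc n)"
    by auto
  show ?case
  proof (cases "i = Suc n")
    case False
    then have "i \<le> n"
      using Suc.prems by simp
    then show ?thesis
      using Suc.IH[OF BV(2)] BV(1) by blast
  qed (use BV in blast)
qed auto

section \<open>Perfect irreducible maps\<close>

text \<open>The fibre \<open>F\<close> of \<open>x\<close> is open. If it had a second point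
  \<open>z\<close>, then removing from \<open>X\<close> the part of \<open>F\<close> in a
  neighbourhood of \<open>x\<close> missing \<open>z\<close> would leave a proper closed set. Its
  image is still everything, since \<open>z\<close> attains the only value that could be
  lost.\<close>

lemma isolated_point_if_isolated_image:
  assumes "Hausdorff_space X" "continuous_map X Y f" "irreducible_map X Y f"
    and x: "x \<in> topspace X" and iso: "isolated_point Y (f x)"
  shows "isolated_point X x"
proof -
  define F where "F = {z \<in> topspace X. f z \<in> {f x}}"
  have F: "openin X F"
    unfolding F_def
    using assms(2) iso openin_continuous_map_preimage unfolding isolated_point_def by blast
  have "F = {x}"
  proof (rule ccontr)
    assume "F \<noteq> {x}"
    then obtain z where z: "z \<in> topspace X" "f z = f x" "z \<noteq> x"
      using x unfolding F_def by blast
    then obtain U V where UV: "openin X U" "openin X V" "x \<in> U" "z \<in> V" "disjnt U V"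
      using \<open>Hausdorff_space X\<close> x unfolding Hausdorff_space_def by metis
    define C where "C = topspace X - (U \<inter> F)"
    have "closedin X C"
      unfolding C_def using UV F by blast
    moreover have "C \<subset> topspace X"
      unfolding C_def F_def using x UV by blast
    moreover have "f ` C = f ` topspace X"
    proof
      show "f ` topspace X \<subseteq> f ` C"
      proof
        fix y assume "y \<in> f ` topspace X"
        then obtain w where w: "w \<in> topspace X" "y = f w"
          by blast
        have "z \<in> C"
          using z UV unfolding C_def disjnt_def by blast
        show "y \<in> f ` C"
        proof (cases "w \<in> C")
          case False
          then have "y = f z"
            using w z unfolding C_def F_def by simp
          then show ?thesis
            using \<open>z \<in> C\<close> by blast
        qed (use w in blast)
      qed
    qed (auto simp: C_def)
    ultimately show False
      using \<open>irreducible_map X Y f\<close> unfolding irreducible_map_def by metis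
  qed
  then show ?thesis
    using F unfolding isolated_point_def by simp
qed

lemma regular_space_small_square:
  assumes "regular_space X" "openin (prod_topology X X) D" "(x, x) \<in> D"
  obtains U where "openin X U" "x \<in> U" "(X closure_of U) \<times> (X closure_of U) \<subseteq> D"
proof -
  obtain A B where AB: "openin X A" "openin X B" "x \<in> A" "x \<in> B" "A \<times> B \<subseteq> D"
    using assms unfolding openin_prod_topology_alt by metis
  then have "openin X (A \<inter> B)" "x \<in> A \<inter> B"
    by blast+
  then obtain U C where "openin X U" "closedin X C" "x \<in> U" "U \<subseteq> C" "C \<subseteq> A \<inter> B"
    using \<open>regular_space X\<close> unfolding neighbourhood_base_of_closedin[symmetric] neighbourhood_base_of
    by metis
  moreover from this have "X closure_of U \<subseteq> C"
    by (simp add: closure_of_minimal)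
  ultimately show thesis
    using AB by (intro that[of U]) blast+
qed

text \<open>Compactness of the fibre gives a finite cover by small sets, and closedness of
  \<open>f\<close> extends it to the preimage of a neighbourhood of \<open>y\<close>. Finiteness of
  \<open>\<G>\<close> later yields point-finiteness on \<open>X\<close>.\<close>

lemma perfect_map_fibre_small_cover:
  assumes perf: "perfect_map X Y f" and "regular_space X"
    and D: "openin (prod_topology X X) D" "(\<lambda>x. (x, x)) ` topspace X \<subseteq> D"
    and y: "y \<in> topspace Y"
  shows "\<exists>H \<G>. openin Y H \<and> y \<in> H \<and> finite \<G> \<and> {x \<in> topspace X. f x \<in> H} \<subseteq> \<Union> \<G> \<and>
           (\<forall>G\<in>\<G>. openin X G \<and> (X closure_of G) \<times> (X closure_of G) \<subseteq> D)"
proof -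
  define \<U> where "\<U> = {G. openin X G \<and> (X closure_of G) \<times> (X closure_of G) \<subseteq> D}"
  have cm: "closed_map X Y f" and K: "compactin X {x \<in> topspace X. f x = y}"
    using perf y unfolding perfect_map_def proper_map_def by auto
  have "{x \<in> topspace X. f x = y} \<subseteq> \<Union> \<U>"
  proof
    fix x assume "x \<in> {x \<in> topspace X. f x = y}"
    then obtain U where "openin X U" "x \<in> U" "(X closure_of U) \<times> (X closure_of U) \<subseteq> D"
      using regular_space_small_square[OF \<open>regular_space X\<close> D(1)] D(2) by blast
    then show "x \<in> \<Union> \<U>"
      unfolding \<U>_def by blast
  qed
  then obtain \<G> where \<G>: "finite \<G>" "\<G> \<subseteq> \<U>" "{x \<in> topspace X. f x = y} \<subseteq> \<Union> \<G>"
    using K unfolding compactin_def \<U>_def by (metis (no_types, lifting) mem_Collect_eq)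
  then have "openin X (\<Union> \<G>)"
    unfolding \<U>_def by blast
  then obtain H where "openin Y H" "y \<in> H" "{x \<in> topspace X. f x \<in> H} \<subseteq> \<Union> \<G>"
    using cm y \<G>(3) unfolding closed_map_fibre_neighbourhood by meson
  moreover have "\<forall>G\<in>\<G>. openin X G \<and> (X closure_of G) \<times> (X closure_of G) \<subseteq> D"
    using \<G>(2) unfolding \<U>_def by blast
  ultimately show ?thesis
    using \<G>(1) by (intro exI[of _ H] exI[of _ \<G>] conjI)
qed

section \<open>Pulling a development back along the map\<close>

theorem theorem3p13:
  fixes X :: "'a topology" and Y :: "'b topology" and f :: "'a \<Rightarrow> 'b"
  assumes "Hausdorff_space X" and "Hausdorff_space Y"
    and "perfect_map X Y f" and "irreducible_map X Y f"
    and "regular_space X" and "has_gdelta_diagonal X"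
    and "has_uniform_base_at_nonisolated Y"
  shows "has_uniform_base_at_nonisolated X"
proof -
  have cont: "continuous_map X Y f" and cm: "closed_map X Y f"
    and K: "\<And>y. y \<in> topspace Y \<Longrightarrow> compactin X {x \<in> topspace X. f x = y}"
    using \<open>perfect_map X Y f\<close> unfolding perfect_map_def proper_map_def by auto
  have fY: "f x \<in> topspace Y" if "x \<in> topspace X" for x
    using that cont continuous_map_image_subset_topspace by blast
  have nonisolated: "\<not> isolated_point Y (f x)"
    if "x \<in> topspace X" "\<not> isolated_point X x" for x
    using isolated_point_if_isolated_image assms cont that by metis
  obtain D :: "nat \<Rightarrow> ('a \<times> 'a) set" where D: "\<And>n. openin (prod_topology X X) (D n)"
    and diag: "\<Inter> (range D) = (\<lambda>x. (x, x)) ` topspace X"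
    using \<open>has_gdelta_diagonal X\<close> unfolding has_gdelta_diagonal_def gdelta_in_descending by metis
  have diagD: "(\<lambda>x. (x, x)) ` topspace X \<subseteq> D n" for n
    using diag by blast
  \<comment> \<open>This property passes from \<open>H\<close> to its subsets, hence from
    \<open>\<H> n\<close> to the members of the refinement \<open>\<M> n\<close>.\<close>
  define good where "good n H \<G> \<longleftrightarrow> finite \<G> \<and> {x \<in> topspace X. f x \<in> H} \<subseteq> \<Union> \<G> \<and>
      (\<forall>G\<in>\<G>. openin X G \<and> (X closure_of G) \<times> (X closure_of G) \<subseteq> D n)" for n H \<G>
  define \<H> where "\<H> n = {H. openin Y H \<and> (\<exists>\<G>. good n H \<G>)}" for n
  have \<H>_open: "openin Y H" if "H \<in> \<H> n" for n H
    using that unfolding \<H>_def by simp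
  have \<H>_cover: "topspace Y \<subseteq> \<Union> (\<H> n)" for n
  proof
    fix y assume "y \<in> topspace Y"
    from perfect_map_fibre_small_cover
      [OF \<open>perfect_map X Y f\<close> \<open>regular_space X\<close> D[of n] diagD this]
    have "\<exists>H \<G>. openin Y H \<and> y \<in> H \<and> good n H \<G>"
      unfolding good_def .
    then show "y \<in> \<Union> (\<H> n)"
      unfolding \<H>_def by blast
  qed
  have "\<exists>\<M>. point_finite_development Y \<M> \<and> (\<forall>n. \<forall>M\<in>\<M> n. \<exists>H\<in>\<H> n. M \<subseteq> H)"
    by (rule point_finite_development_refining[OF Hausdorff_imp_t1_space])
      (fact assms \<H>_open \<H>_cover)+
  then obtain \<M> where \<M>: "point_finite_development Y \<M>"
    and \<M>_refine: "\<forall>n. \<forall>M\<in>\<M> n. \<exists>H\<in>\<H> n. M \<subseteq> H"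
    by blast
  have \<M>_open: "openin Y M" if "M \<in> \<M> n" for n M
    using \<M> that unfolding point_finite_development_def by simp
  have \<M>_cover: "\<exists>M\<in>\<M> n. y \<in> M" and \<M>_finite: "finite {M \<in> \<M> n. y \<in> M}"
    if "y \<in> topspace Y" "\<not> isolated_point Y y" for n y
    using \<M> that unfolding point_finite_development_def by simp_all
  have \<M>_dev: "\<forall>\<^sub>F n in sequentially. \<forall>M\<in>\<M> n. y \<in> M \<longrightarrow> M \<subseteq> W"
    if "openin Y W" "y \<in> W" "\<not> isolated_point Y y" for y W
    using \<M> that unfolding point_finite_development_def by simp
  define \<Phi> where "\<Phi> n M = (SOME \<G>. good n M \<G>)" for n M
  have some_good: "\<exists>\<G>. good n M \<G>" if M: "M \<in> \<M> n" for n M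
  proof -
    obtain H \<G> where H: "M \<subseteq> H" "good n H \<G>"
      using \<M>_refine M unfolding \<H>_def by blast
    then have "{x \<in> topspace X. f x \<in> M} \<subseteq> {x \<in> topspace X. f x \<in> H}"
      by blast
    with H(2) have "good n M \<G>"
      unfolding good_def by (meson order_trans)
    then show ?thesis ..
  qed
  have \<Phi>: "good n M (\<Phi> n M)" if "M \<in> \<M> n" for n M
    unfolding \<Phi>_def by (rule someI_ex[OF some_good[OF that]])
  define \<V> where
    "\<V> n = (\<Union>M\<in>\<M> n. (\<lambda>G. {x \<in> topspace X. f x \<in> M} \<inter> G) ` \<Phi> n M)" for n
  have \<V>_open: "openin X V" if V: "V \<in> \<V> n" for n V
  proof -
    obtain M U where "M \<in> \<M> n" "U \<in> \<Phi> n M" "V = {x \<in> topspace X. f x \<in> M} \<inter> U"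
      using V unfolding \<V>_def by blast
    moreover from this have "openin X {x \<in> topspace X. f x \<in> M}" "openin X U"
      using \<M>_open openin_continuous_map_preimage[OF cont] \<Phi> unfolding good_def by blast+
    ultimately show ?thesis
      by blast
  qed
  have \<V>_square: "(X closure_of V) \<times> (X closure_of V) \<subseteq> D n" if V: "V \<in> \<V> n" for n V
  proof -
    obtain M U where MU: "M \<in> \<M> n" "U \<in> \<Phi> n M" "V = {x \<in> topspace X. f x \<in> M} \<inter> U"
      using V unfolding \<V>_def by blast
    then have "X closure_of V \<subseteq> X closure_of U"
      by (intro closure_of_mono) blast
    moreover have "(X closure_of U) \<times> (X closure_of U) \<subseteq> D n"
      using \<Phi> MU unfolding good_def by blast
    ultimately show ?thesis
      by blast
  qed
  have \<V>_cover: "\<exists>V\<in>\<V> n. x \<in> V" if x: "x \<in> topspace X" "\<not> isolated_point X x" for n x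
  proof -
    obtain M where M: "M \<in> \<M> n" "f x \<in> M"
      using \<M>_cover[OF fY[OF x(1)] nonisolated[OF x]] by blast
    then obtain U where U: "U \<in> \<Phi> n M" "x \<in> U"
      using \<Phi>[OF M(1)] x unfolding good_def by blast
    have "{x \<in> topspace X. f x \<in> M} \<inter> U \<in> \<V> n"
      unfolding \<V>_def by (intro UN_I[OF M(1)] imageI U(1))
    then show ?thesis
      by (rule rev_bexI) (simp add: M(2) U(2) x(1))
  qed
  \<comment> \<open>Finitely many members of \<open>\<M> n\<close> contain \<open>f x\<close>,
    because \<open>f x\<close> is non-isolated, and each is cut into finitely many pieces.\<close>
  have \<V>_finite: "finite {V \<in> \<V> n. x \<in> V}"
    if x: "x \<in> topspace X" "\<not> isolated_point X x" for n x
  proof (rule finite_subset)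
    show "{V \<in> \<V> n. x \<in> V}
        \<subseteq> (\<Union>M\<in>{M \<in> \<M> n. f x \<in> M}. (\<lambda>G. {x \<in> topspace X. f x \<in> M} \<inter> G) ` \<Phi> n M)"
      unfolding \<V>_def by auto
    show "finite \<dots>"
      using \<M>_finite[OF fY[OF x(1)] nonisolated[OF x]] \<Phi> unfolding good_def by simp
  qed
  have dev: "\<forall>\<^sub>F n in sequentially. \<forall>A\<in>meets \<V> n. x \<in> A \<longrightarrow> A \<subseteq> W"
    if W: "openin X W" "x \<in> W" and x': "\<not> isolated_point X x" for x W
  proof -
    have x: "x \<in> topspace X"
      using W openin_subset by blast
    define K where "K = {z \<in> topspace X. f z = f x}"
    \<comment> \<open>A finite union of \<open>far\<close> sets is again avoided eventually, so
      compactness reduces the claim to finding a \<open>far\<close> neighbourhood of each fibre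
      point outside \<open>W\<close>.\<close>
    define far where
      "far U \<longleftrightarrow> (\<forall>\<^sub>F n in sequentially. \<forall>A\<in>meets \<V> n. x \<in> A \<longrightarrow> A \<inter> U = {})" for U
    have sep: "\<exists>U. openin X U \<and> z \<in> U \<and> far U" if z: "z \<in> K - W" for z
    proof -
      have "(x, z) \<notin> \<Inter> (range D)"
        using z W unfolding diag by blast
      then obtain m where m: "(x, z) \<notin> D m"
        by blast
      \<comment> \<open>A finite union of closures, hence closed. If \<open>z\<close> were in
        \<open>C\<close>, then \<open>x\<close> and \<open>z\<close> would lie in the closure of one
        member of \<open>\<V> m\<close>, forcing \<open>(x, z)\<close> into
        \<open>D m\<close>.\<close>
      define C where "C = (\<Union>V\<in>{V \<in> \<V> m. x \<in> V}. X closure_of V)"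
      have "closedin X C"
        unfolding C_def using \<V>_finite[OF x x'] by (intro closedin_Union) auto
      then have "openin X (topspace X - C)"
        by blast
      moreover have "z \<in> topspace X - C"
      proof -
        have "x \<in> X closure_of V" if "x \<in> V" for V
          using that x by (simp add: in_closure_of) blast
        then have "z \<notin> C"
          using m \<V>_square unfolding C_def by blast
        then show ?thesis
          using z unfolding K_def by blast
      qed
      \<comment> \<open>From stage \<open>m\<close> on, \<open>A\<close> lies in some member of
        \<open>\<V> m\<close>, which contains \<open>x\<close> because \<open>A\<close> does and is
        therefore part of \<open>C\<close>.\<close>
      moreover have "A \<inter> (topspace X - C) = {}" if A: "A \<in> meets \<V> n" "x \<in> A" "m \<le> n" for n A
      proof -
        obtain V where V: "V \<in> \<V> m" "A \<subseteq> V"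
          using meets_refine[OF A(1,3)] by blast
        have "V \<subseteq> X closure_of V"
          by (rule closure_of_subset[OF openin_subset[OF \<V>_open[OF V(1)]]])
        then show ?thesis
          using V A unfolding C_def by blast
      qed
      ultimately show ?thesis
        unfolding far_def eventually_sequentially by blast
    qed
    have "compactin X (K \<inter> (topspace X - W))"
      using K[OF fY[OF x]] W unfolding K_def by (intro compact_Int_closedin) auto
    moreover have "K \<inter> (topspace X - W) \<subseteq> \<Union> {U. openin X U \<and> far U}"
      using sep by blast
    ultimately obtain \<F> where \<F>: "finite \<F>" "\<F> \<subseteq> {U. openin X U \<and> far U}"
        "K \<inter> (topspace X - W) \<subseteq> \<Union> \<F>"
      unfolding compactin_def by (metis (no_types, lifting) mem_Collect_eq)
    have "openin X (W \<union> \<Union> \<F>)"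
      using W \<F> by blast
    moreover have "K \<subseteq> W \<union> \<Union> \<F>"
      using \<F>(3) unfolding K_def by blast
    \<comment> \<open>Closedness of \<open>f\<close> turns an open set around the fibre into one
      containing the full preimage of a neighbourhood of \<open>f x\<close>.\<close>
    ultimately obtain H where H: "openin Y H" "f x \<in> H"
        "{z \<in> topspace X. f z \<in> H} \<subseteq> W \<union> \<Union> \<F>"
      using cm fY[OF x] unfolding closed_map_fibre_neighbourhood K_def by meson
    have "\<forall>\<^sub>F n in sequentially. \<forall>U\<in>\<F>. \<forall>A\<in>meets \<V> n. x \<in> A \<longrightarrow> A \<inter> U = {}"
      using \<F> unfolding far_def by (intro eventually_ball_finite) blast+
    moreover have "\<forall>\<^sub>F n in sequentially. \<forall>M\<in>\<M> n. f x \<in> M \<longrightarrow> M \<subseteq> H"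
      by (rule \<M>_dev[OF H(1,2) nonisolated[OF x x']])
    ultimately show ?thesis
    proof eventually_elim
      case (elim n)
      show ?case
      proof (intro ballI impI)
        fix A assume A: "A \<in> meets \<V> n" "x \<in> A"
        then obtain V where "V \<in> \<V> n" "A \<subseteq> V"
          using meets_refine[OF A(1) order_refl] by blast
        then obtain M where "M \<in> \<M> n" "A \<subseteq> {z \<in> topspace X. f z \<in> M}"
          unfolding \<V>_def by blast
        \<comment> \<open>Since \<open>x\<close> is in \<open>A\<close>, \<open>M\<close> contains
          \<open>f x\<close> and so lies in \<open>H\<close>; as \<open>A\<close> also misses every
          set in \<open>\<F>\<close>, only \<open>W\<close> remains.\<close>
        then have "A \<subseteq> W \<union> \<Union> \<F>"
          using elim(2) A H(3) by blast
        then show "A \<subseteq> W"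
          using elim(1) A by blast
      qed
    qed
  qed
  have "point_finite_development X (meets \<V>)"
    unfolding point_finite_development_def
  proof (intro conjI allI ballI impI)
    show "openin X A" if "A \<in> meets \<V> n" for n A
      using openin_meets[OF \<V>_open that] .
    show "\<exists>A\<in>meets \<V> n. x \<in> A" "finite {A \<in> meets \<V> n. x \<in> A}"
      if "x \<in> topspace X" "\<not> isolated_point X x" for n x
      using meets_cover[OF \<V>_cover[OF that]] meets_point_finite[OF \<V>_finite[OF that]] .
    show "\<forall>\<^sub>F n in sequentially. \<forall>A\<in>meets \<V> n. x \<in> A \<longrightarrow> A \<subseteq> U"
      if "openin X U \<and> x \<in> U \<and> \<not> isolated_point X x" for x U
      using that by (intro dev) simp_all
  qed
  then show ?thesis
    by (rule has_uniform_base_if_development)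
qed

end
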